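(* Let $n \geqslant 3$, let $q$ be a power of a prime $p$, and let $\mathbb{K}$ be an algebraically closed field of characteristic $0$. Let $V$ be a non-trivial, irreducible $\mathbb{K}$-linear representation of $\mathrm{SL}_n(\mathbb{Z}/q\mathbb{Z})$. Then \[ \dim V \geqslant \begin{cases} 2 & \text{if } (n,p) = (3,2), \\ p^{n-1} - 1 & \text{otherwise.} \end{cases} \]
   Context: $\mathbb{Z}/q\mathbb{Z}$ denotes the ring of integers modulo $q$, and $\mathrm{SL}_n(\mathbb{Z}/q\mathbb{Z})$ is the group of $n \times n$ matrices over this ring with determinant $1$. A representation is non-trivial if some group element does not act as the identity. *)

theory Defs
  imports
    Berlekamp_Zassenhaus.Finite_Field
    Jordan_Normal_Form.Determinant
    "HOL-Algebra.Group"
begin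

text \<open>
  Here \<open>'q mod_ring\<close> is the ring of integers modulo \<open>CARD('q)\<close>, so
  \<open>SL n :: 'q mod_ring mat monoid\<close> is the special linear group over that ring.
\<close>

definition SL :: "nat \<Rightarrow> 'a :: comm_ring_1 mat monoid" where
  "SL n = \<lparr>carrier = {A \<in> carrier_mat n n. det A = 1}, monoid.mult = (*), monoid.one = 1\<^sub>m n\<rparr>"

definition GL :: "('k :: field \<Rightarrow> 'v :: ab_group_add \<Rightarrow> 'v) \<Rightarrow> ('v \<Rightarrow> 'v) monoid" where
  "GL scale = \<lparr>carrier = {f. Vector_Spaces.linear scale scale f \<and> bij f}, monoid.mult = (\<circ>), monoid.one = id\<rparr>"

text \<open>
  The representation space is the whole type \<open>'v\<close>, made into a vector space by \<open>scale\<close>;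
  it is not assumed to be finite-dimensional.
\<close>

locale linear_representation =
  vector_space scale + group_hom G "GL scale" \<rho>
  for scale :: "'k :: field \<Rightarrow> 'v :: ab_group_add \<Rightarrow> 'v"
    and G :: "('g, 'b) monoid_scheme" (structure)
    and \<rho> :: "'g \<Rightarrow> 'v \<Rightarrow> 'v"
begin

definition nontrivial :: bool where
  "nontrivial \<longleftrightarrow> (\<exists>g\<in>carrier G. \<rho> g \<noteq> id)"

definition invariant :: "'v set \<Rightarrow> bool" where
  "invariant W \<longleftrightarrow> (\<forall>g\<in>carrier G. \<forall>w\<in>W. \<rho> g w \<in> W)"

definition irreducible :: bool where
  "irreducible \<longleftrightarrow> (UNIV :: 'v set) \<noteq> {0} \<and>
     (\<forall>W. subspace W \<and> invariant W \<longrightarrow> W = {0} \<or> W = UNIV)"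

end

lemma group_SL: "group (SL n :: 'a :: comm_ring_1 mat monoid)"
proof (rule groupI)
  fix A :: "'a mat" assume A: "A \<in> carrier (SL n)"
  then have A': "A \<in> carrier_mat n n" and d: "det A = 1" by (auto simp: SL_def)
  note adj = adj_mat[OF A']
  have "adj_mat A * A = 1\<^sub>m n" using adj(3) d by (auto intro!: eq_matI)
  moreover from this have "det (adj_mat A) * det A = 1"
    using det_mult[OF adj(1) A'] by simp
  ultimately show "\<exists>B\<in>carrier (SL n). B \<otimes>\<^bsub>SL n\<^esub> A = \<one>\<^bsub>SL n\<^esub>"
    using adj(1) d by (intro bexI[of _ "adj_mat A"]) (auto simp: SL_def)
qed (auto simp: SL_def det_mult)

lemma (in vector_space) group_GL: "group (GL scale)"
proof (rule groupI)
  fix f assume "f \<in> carrier (GL scale)"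
  then have f: "Vector_Spaces.linear scale scale f" "bij f" by (auto simp: GL_def)
  interpret f: Vector_Spaces.linear scale scale f by (rule f(1))
  define g where "g = inv_into UNIV f"
  have s: "f (g x) = x" for x unfolding g_def using f(2) by (simp add: bij_is_surj surj_f_inv_f)
  have i: "g (f x) = x" for x unfolding g_def using f(2) by (simp add: bij_is_inj)
  have "Vector_Spaces.linear scale scale g"
  proof unfold_locales
    show "g (x + y) = g x + g y" for x y
      using i[of "g x + g y"] by (simp add: f.add s)
    show "g (scale c x) = scale c (g x)" for c x
      using i[of "scale c (g x)"] by (simp add: f.scale s)
  qed
  then show "\<exists>g\<in>carrier (GL scale). g \<otimes>\<^bsub>GL scale\<^esub> f = \<one>\<^bsub>GL scale\<^esub>"
    using f(2) by (intro bexI[of _ g]) (auto simp: GL_def g_def bij_imp_bij_inv bij_is_inj)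
qed (auto simp: GL_def o_assoc bij_comp linear_id id_def[symmetric]
       intro: Vector_Spaces.linear_compose)

end

theory Submission
  imports Defs
begin

text \<open>
  Write \<open>R\<close> for the ring of integers modulo \<open>q\<close> and \<open>m = n - 1\<close>. The matrices that differ
  from the identity only in the first \<open>m\<close> entries of the last column form a subgroup \<open>N\<close>,
  isomorphic to the additive group of \<open>R\<^sup>m\<close>, and \<open>N\<close> is normalised by the copy of
  \<open>SL\<^sub>m(R)\<close> in the upper left corner. The field contains a primitive \<open>q\<close>-th root of unity, so
  \<open>V\<close> splits under \<open>N\<close> into weight spaces for the characters \<open>a \<mapsto> \<chi>(w \<bullet> a)\<close> with \<open>w \<in> R\<^sup>m\<close>. The normalising subgroup permutes the weights.

  If only \<open>w = 0\<close> occurs, then \<open>N\<close> acts trivially. Commutators then put every shear into the kernel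
  (\<open>column_shears_normal_closure\<close>), and since \<open>R\<close> is local, Gaussian elimination writes
  every element of \<open>SL\<^sub>n(R)\<close> as a product of shears (\<open>SL_shear_reduce\<close>). Hence \<open>V\<close> is trivial, which
  is excluded. So some weight \<open>w \<noteq> 0\<close> occurs (\<open>nontrivial_weight_exists\<close>).

  The ideals of \<open>R\<close> form a chain, so \<open>w\<close> is a multiple \<open>d \<cdot> c\<close> of a vector \<open>c\<close> with an entry 1.
  Since \<open>m \<ge> 2\<close>, transvections carry \<open>c\<close> to every vector with a unit entry (\<open>chain_ring_orbit\<close>), so every \<open>d \<cdot> x\<close>
  with \<open>x\<close> a nonzero vector of residues in \<open>{0, \<dots>, p - 1}\<close> is a weight. Differences of distinct
  residues are units, so these \<open>p\<^sup>m - 1\<close> weights are distinct, and weight vectors for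
  distinct weights are linearly independent (\<open>weight_vectors_independent\<close>). This gives the bound
  \<open>p\<^sup>m - 1\<close> in all cases; for \<open>(n, p) = (3, 2)\<close> it equals 3.

  An irreducible representation of a finite group is spanned by one orbit. This makes the space
  finite-dimensional, so that the cardinality of an independent set bounds the dimension.
\<close>

section \<open>Shears and elimination over a local ring\<close>

(* Matrix products are evaluated by shear_mult_index, not as scalar products of rows and columns. *)
declare index_mult_mat(1) [simp del]

text \<open>
  Shears with a whole column of off-diagonal entries serve two purposes at once: a single one clears
  a column in elimination, and those with \<open>i = n - 1\<close> form the abelian group of translations. Only
  the case \<open>y i = 0\<close> is a shear in the geometric sense.
\<close>
definition shear :: "nat \<Rightarrow> nat \<Rightarrow> (nat \<Rightarrow> 'a) \<Rightarrow> 'a :: comm_ring_1 mat" where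
  "shear n i y = mat n n (\<lambda>(r, c). (if r = c then 1 else 0) + (if c = i then y r else 0))"

lemma shear_carrier [simp]: "shear n i y \<in> carrier_mat n n"
  by (simp add: shear_def)

lemma shear_dim [simp]: "dim_row (shear n i y) = n" "dim_col (shear n i y) = n"
  by (simp_all add: shear_def)

lemma shear_index:
  "r < n \<Longrightarrow> c < n \<Longrightarrow> shear n i y $$ (r, c) = (if r = c then 1 else 0) + (if c = i then y r else 0)"
  by (simp add: shear_def)

lemma shear_mult_index:
  assumes "A \<in> carrier_mat n nc" "i < n" "r < n" "c < nc"
  shows "(shear n i y * A) $$ (r, c) = A $$ (r, c) + y r * A $$ (i, c)"
proof -
  have "(shear n i y * A) $$ (r, c) = (\<Sum>k = 0..<n. shear n i y $$ (r, k) * A $$ (k, c))"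
    using assms by (simp add: index_mult_mat(1) scalar_prod_def)
  also have "\<dots> = (\<Sum>k = 0..<n. (if k = r then A $$ (k, c) else 0) + (if k = i then y r * A $$ (k, c) else 0))"
    using assms by (intro sum.cong) (auto simp: shear_index distrib_right)
  also have "\<dots> = A $$ (r, c) + y r * A $$ (i, c)"
    using assms by (simp add: sum.distrib)
  finally show ?thesis .
qed

lemma shear_mult_shear:
  assumes "i < n" "z i = 0"
  shows "shear n i y * shear n i z = shear n i (\<lambda>r. y r + z r)"
  by (rule eq_matI) (use assms in \<open>auto simp: shear_mult_index[where nc = n] shear_index\<close>)

lemma shear_zero: "(\<And>r. r < n \<Longrightarrow> y r = 0) \<Longrightarrow> shear n i y = 1\<^sub>m n"
  by (rule eq_matI) (auto simp: shear_index)

lemma shear_single: "shear n i (\<lambda>r. if r = j then t else 0) = addrow_mat n t j i" if "i \<noteq> j"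
  using that by (intro eq_matI) (auto simp: shear_index)

lemma det_shear:
  assumes "i < n" "y i = 0"
  shows "det (shear n i y) = 1"
proof -
  have "det (shear n i (\<lambda>r. if r < k then y r else 0)) = 1" for k
  proof (induction k)
    case 0
    then show ?case by (simp add: shear_zero)
  next
    case (Suc k)
    show ?case
    proof (cases "k = i")
      case True
      then have "(\<lambda>r. if r < Suc k then y r else 0) = (\<lambda>r. if r < k then y r else 0)"
        using assms by (auto simp: less_Suc_eq)
      with Suc show ?thesis by simp
    next
      case False
      have "shear n i (\<lambda>r. if r < Suc k then y r else 0) =
          shear n i (\<lambda>r. if r = k then y k else 0) * shear n i (\<lambda>r. if r < k then y r else 0)"
        using assms by (subst shear_mult_shear) (auto simp: less_Suc_eq intro!: arg_cong[of _ _ "shear n i"] ext)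
      also have "det \<dots> = 1"
        using Suc False by (subst det_mult[where n = n]) (auto simp: shear_single det_addrow_mat)
      finally show ?thesis .
    qed
  qed
  moreover have "shear n i (\<lambda>r. if r < n then y r else 0) = shear n i y"
    by (rule eq_matI) (auto simp: shear_index)
  ultimately show ?thesis by metis
qed

lemma shear_in_SL: "i < n \<Longrightarrow> y i = 0 \<Longrightarrow> shear n i y \<in> carrier (SL n)"
  by (simp add: SL_def det_shear)

lemma SL_carrierD: "A \<in> carrier (SL n) \<Longrightarrow> A \<in> carrier_mat n n"
  by (simp add: SL_def)

lemma SL_mult: "A \<otimes>\<^bsub>SL n\<^esub> B = A * B"
  by (simp add: SL_def)

lemma shear_mult_in_SL:
  "i < n \<Longrightarrow> y i = 0 \<Longrightarrow> A \<in> carrier (SL n) \<Longrightarrow> shear n i y * A \<in> carrier (SL n)"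
  using shear_in_SL[of i n y] by (auto simp: SL_def det_mult[of _ n])

text \<open>
  Total divisibility makes the ring local: one of two summands divides the other and hence their sum, so it is
  a unit whenever the sum is. Iterating this handles finite sums.
\<close>
lemma unit_summand:
  fixes f :: "'i \<Rightarrow> 'a :: comm_ring_1"
  assumes total: "\<And>x y :: 'a. x dvd y \<or> y dvd x"
    and "finite I" "sum f I dvd 1"
  shows "\<exists>i\<in>I. f i dvd 1"
  using assms(2, 3)
proof (induction I rule: finite_induct)
  case (insert i I)
  from total[of "f i" "sum f I"] have "f i dvd 1 \<or> sum f I dvd 1"
  proof
    assume "f i dvd sum f I"
    then have "f i dvd sum f (insert i I)" using insert.hyps by simp
    then show ?thesis using insert.prems by (metis dvd_trans)
  next
    assume "sum f I dvd f i"
    then have "sum f I dvd sum f (insert i I)" using insert.hyps by simp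
    then show ?thesis using insert.prems by (metis dvd_trans)
  qed
  then show ?case using insert.IH by auto
qed simp

text \<open>
  Gaussian elimination by row operations alone, column by column. It is phrased as an induction
  principle: a property is inherited by \<open>A\<close> from \<open>shear n i y * A\<close>, so reducing \<open>A\<close> to the identity
  proves it for \<open>A\<close>. There is always a unit on or below the diagonal of the current
  column because the inverse matrix expresses 1 as a combination of those entries. A unit below the
  diagonal turns the pivot into 1, and a unit on the diagonal is first used to create a unit in the
  next row; in the last column, where there is no next row, the determinant forces the pivot to be 1.
\<close>
lemma SL_shear_reduce:
  fixes P :: "'a :: comm_ring_1 mat \<Rightarrow> bool"
  assumes total: "\<And>x y :: 'a. x dvd y \<or> y dvd x"
    and n: "n \<ge> 2"
    and one: "P (1\<^sub>m n)"
    and reduce: "\<And>i y A. i < n \<Longrightarrow> y i = 0 \<Longrightarrow> A \<in> carrier (SL n) \<Longrightarrow> P (shear n i y * A) \<Longrightarrow> P A"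
    and A: "A \<in> carrier (SL n)"
  shows "P A"
proof -
  define std where "std k A \<longleftrightarrow> (\<forall>c<k. \<forall>r<n. A $$ (r, c) = (if r = c then 1 else 0))"
    for k and A :: "'a mat"
  have "P A" if "k \<le> n" "A \<in> carrier (SL n)" "std k A" for k A
    using that
  proof (induction k arbitrary: A rule: inc_induct)
    case base
    then have "A = 1\<^sub>m n" by (intro eq_matI) (auto simp: std_def SL_def)
    with one show ?case by simp
  next
    case (step k)
    have std_shear: "std k (shear n i y * B)" if "k \<le> i" "i < n" "std k B" "B \<in> carrier (SL n)" for i y B
      unfolding std_def
      using that step.hyps by (auto simp: std_def shear_mult_index[where nc = n] SL_carrierD)
    \<comment> \<open>A pivot equal to 1 clears the whole column by a single shear.\<close>
    have pivot: "P B" if B: "B \<in> carrier (SL n)" "std k B" "B $$ (k, k) = 1" for B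
    proof -
      let ?y = "\<lambda>r. if r = k then 0 else - B $$ (r, k)"
      have "std (Suc k) (shear n k ?y * B)"
        using B step.hyps std_shear[of k B ?y] 
        by (auto simp: std_def less_Suc_eq shear_mult_index[where nc = n] SL_carrierD)
      then have "P (shear n k ?y * B)"
        using B step.hyps by (intro step.IH shear_mult_in_SL) auto
      then show ?thesis using B step.hyps by (intro reduce[of k ?y B]) auto
    qed
    have below: "P B" if B: "B \<in> carrier (SL n)" "std k B" and i: "k < i" "i < n" "B $$ (i, k) dvd 1" for B i
    proof -
      obtain u where u: "B $$ (i, k) * u = 1" using i(3) by (auto simp: dvd_def)
      let ?y = "\<lambda>r. if r = k then (1 - B $$ (k, k)) * u else 0"
      have "(shear n i ?y * B) $$ (k, k) = B $$ (k, k) + (1 - B $$ (k, k)) * (B $$ (i, k) * u)"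
        using B i by (subst shear_mult_index[where nc = n]) (auto simp: SL_carrierD algebra_simps)
      then have "P (shear n i ?y * B)"
        using B i u by (intro pivot shear_mult_in_SL std_shear) auto
      then show ?thesis using B i by (intro reduce[of i ?y B]) auto
    qed
    have A: "A \<in> carrier_mat n n" using step.prems by (simp add: SL_carrierD)
    show ?case
    proof (cases "Suc k = n")
      case True
      have "upper_triangular A"
        using step.prems A True by (auto simp: std_def)
      then have "det A = prod_list (diag_mat A)" using A by (rule det_upper_triangular)
      also have "\<dots> = (\<Prod>i = 0..<Suc k. A $$ (i, i))" using A True by (simp add: prod_list_diag_prod)
      also have "\<dots> = A $$ (k, k)" using step.prems True[symmetric] by (simp add: std_def)
      finally have "A $$ (k, k) = 1" using step.prems by (simp add: SL_def)
      then show ?thesis using step.prems by (intro pivot)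
    next
      case False
      then have k: "Suc k < n" using step.hyps by simp
      interpret group "SL n :: 'a mat monoid" by (rule group_SL)
      obtain B where B: "B \<in> carrier_mat n n" "B * A = 1\<^sub>m n"
        using l_inv[of A] inv_closed[of A] step.prems(1) by (auto simp: SL_def)
      \<comment> \<open>Row k of the inverse is zero before column k, so the entries on and below the diagonal
        of column k generate the unit ideal.\<close>
      have BA: "(\<Sum>s = 0..<n. B $$ (k, s) * A $$ (s, c)) = (if k = c then 1 else 0)" if "c < n" for c
      proof -
        have "(B * A) $$ (k, c) = (1\<^sub>m n :: 'a mat) $$ (k, c)" by (simp only: B(2))
        then show ?thesis
          using B(1) A that step.hyps by (simp add: index_mult_mat(1) scalar_prod_def)
      qed
      have zero: "B $$ (k, c) = 0" if "c < k" for c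
      proof -
        have "(\<Sum>s = 0..<n. B $$ (k, s) * A $$ (s, c)) = (\<Sum>s = 0..<n. if s = c then B $$ (k, s) else 0)"
          using that step.prems(2) by (intro sum.cong) (auto simp: std_def)
        then show ?thesis using BA[of c] that k by simp
      qed
      have "\<exists>s\<in>{0..<n}. B $$ (k, s) * A $$ (s, k) dvd 1"
        using BA[of k] k by (intro unit_summand[OF total]) auto
      then obtain s where s: "s < n" "B $$ (k, s) * A $$ (s, k) dvd 1" by auto
      then have unit: "A $$ (s, k) dvd 1" by (meson dvd_mult_right)
      show ?thesis
      proof (cases "k < s")
        case True
        then show ?thesis using below step.prems s unit by blast
      next
        case False
        with zero[of s] s(2) have "s = k" by (cases "s < k") auto
        with unit obtain u where u: "A $$ (k, k) * u = 1" by (auto simp: dvd_def)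
        let ?y = "\<lambda>r. if r = Suc k then (1 - A $$ (Suc k, k)) * u else 0"
        have "(shear n k ?y * A) $$ (Suc k, k) =
            A $$ (Suc k, k) + (1 - A $$ (Suc k, k)) * (A $$ (k, k) * u)"
          using A k by (subst shear_mult_index[where nc = n]) (auto simp: algebra_simps)
        then have "(shear n k ?y * A) $$ (Suc k, k) dvd 1" using u by simp
        then have "P (shear n k ?y * A)"
          using k step.prems by (intro below[of _ "Suc k"] shear_mult_in_SL std_shear) auto
        then show ?thesis using k step.prems by (intro reduce[of k ?y A]) auto
      qed
    qed
  qed
  from this[of 0 A] A show ?thesis by (simp add: std_def)
qed

section \<open>Weights of a representation of a free module\<close>

lemma finite_carrier_vec [simp]: "finite (carrier_vec m :: 'a :: finite vec set)"
proof (rule finite_subset)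
  show "carrier_vec m \<subseteq> vec m ` ({..<m} \<rightarrow>\<^sub>E (UNIV :: 'a set))"
  proof
    fix v :: "'a vec" assume "v \<in> carrier_vec m"
    then show "v \<in> vec m ` ({..<m} \<rightarrow>\<^sub>E (UNIV :: 'a set))"
      by (intro image_eqI[of _ _ "\<lambda>i\<in>{..<m}. v $ i"] eq_vecI) auto
  qed
  show "finite (vec m ` ({..<m} \<rightarrow>\<^sub>E (UNIV :: 'a set)))"
    by (intro finite_imageI finite_PiE) auto
qed

text \<open>
  A representation \<open>T\<close> of the additive group \<open>R\<^sup>m\<close>, with a faithful character \<open>\<chi>\<close> of the additive group
  of \<open>R\<close>. Fourier analysis on \<open>R\<^sup>m\<close> works with the characters \<open>a \<mapsto> \<chi>(w \<bullet> a)\<close>.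
\<close>
locale module_rep = vector_space scale
  for scale :: "'k :: field_char_0 \<Rightarrow> 'v :: ab_group_add \<Rightarrow> 'v" +
  fixes m :: nat
    and \<chi> :: "'r :: {finite, comm_ring_1} \<Rightarrow> 'k"
    and T :: "'r vec \<Rightarrow> 'v \<Rightarrow> 'v"
  assumes chi_zero: "\<chi> 0 = 1"
    and chi_add: "\<chi> (x + y) = \<chi> x * \<chi> y"
    and chi_eq_1: "\<chi> x = 1 \<Longrightarrow> x = 0"
    and linear_T: "a \<in> carrier_vec m \<Longrightarrow> Vector_Spaces.linear scale scale (T a)"
    and T_zero: "T (0\<^sub>v m) v = v"
    and T_add: "a \<in> carrier_vec m \<Longrightarrow> b \<in> carrier_vec m \<Longrightarrow> T (a + b) v = T a (T b v)"
begin

definition weight_space :: "'r vec \<Rightarrow> 'v set" where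
  "weight_space w = {v. \<forall>a\<in>carrier_vec m. T a v = scale (\<chi> (w \<bullet> a)) v}"

text \<open>
  Up to the factor \<open>card (carrier_vec m)\<close> this is the projection onto \<open>weight_space w\<close>; leaving
  the factor in place avoids divisions.
\<close>
definition weight_proj :: "'r vec \<Rightarrow> 'v \<Rightarrow> 'v" where
  "weight_proj w v = (\<Sum>a\<in>carrier_vec m. scale (\<chi> (- (w \<bullet> a))) (T a v))"

lemma sum_translate:
  fixes f :: "'r vec \<Rightarrow> 'b :: comm_monoid_add"
  assumes "b \<in> carrier_vec m"
  shows "(\<Sum>a\<in>carrier_vec m. f (a + b)) = (\<Sum>a\<in>carrier_vec m. f a)"
  by (rule sum.reindex_bij_witness[of _ "\<lambda>a. a - b" "\<lambda>a. a + b"]) (use assms in auto)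

lemma T_scale: "a \<in> carrier_vec m \<Longrightarrow> T a (scale c v) = scale c (T a v)"
  and T_sum: "a \<in> carrier_vec m \<Longrightarrow> T a (sum f I) = (\<Sum>i\<in>I. T a (f i))"
  and T_0: "a \<in> carrier_vec m \<Longrightarrow> T a 0 = 0"
proof -
  assume "a \<in> carrier_vec m"
  then interpret Ta: Vector_Spaces.linear scale scale "T a" by (rule linear_T)
  show "T a (scale c v) = scale c (T a v)" "T a (sum f I) = (\<Sum>i\<in>I. T a (f i))" "T a 0 = 0"
    by (rule Ta.scale Ta.sum Ta.zero)+
qed

text \<open>
  Orthogonality of characters: translating the summation variable by a unit vector multiplies the sum
  by \<open>\<chi>(w $ r)\<close>, which differs from 1 when \<open>w $ r \<noteq> 0\<close>.
\<close>
lemma sum_chi_eq_0: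
  assumes w: "w \<in> carrier_vec m" "w \<noteq> 0\<^sub>v m"
  shows "(\<Sum>a\<in>carrier_vec m. \<chi> (w \<bullet> a)) = 0"
proof -
  obtain r where r: "r < m" "w $ r \<noteq> 0"
    using w by (metis carrier_vecD eq_vecI index_zero_vec)
  let ?S = "\<Sum>a\<in>carrier_vec m. \<chi> (w \<bullet> a)"
  have "?S = (\<Sum>a\<in>carrier_vec m. \<chi> (w \<bullet> (a + unit_vec m r)))"
    by (subst sum_translate) auto
  also have "\<dots> = (\<Sum>a\<in>carrier_vec m. \<chi> (w \<bullet> a) * \<chi> (w $ r))"
    using w r by (intro sum.cong) (auto simp: scalar_prod_add_distrib[of _ m] chi_add)
  also have "\<dots> = ?S * \<chi> (w $ r)" by (simp add: sum_distrib_right)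
  finally show ?thesis using r chi_eq_1 by auto
qed

lemma weight_proj_in_weight_space:
  assumes w: "w \<in> carrier_vec m"
  shows "weight_proj w v \<in> weight_space w"
  unfolding weight_space_def
proof (intro CollectI ballI)
  fix b :: "'r vec" assume b: "b \<in> carrier_vec m"
  have chi: "\<chi> (- (w \<bullet> a)) = \<chi> (w \<bullet> b) * \<chi> (- (w \<bullet> (a + b)))" if "a \<in> carrier_vec m" for a
    using that b w by (subst chi_add[symmetric]) (simp add: scalar_prod_add_distrib[of _ m])
  have "T b (weight_proj w v) = (\<Sum>a\<in>carrier_vec m. scale (\<chi> (- (w \<bullet> a))) (T (a + b) v))"
    unfolding weight_proj_def T_sum[OF b] T_scale[OF b]
    using b by (intro sum.cong refl) (simp add: T_add[symmetric] comm_add_vec[of _ m])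
  also have "\<dots> = (\<Sum>a\<in>carrier_vec m. scale (\<chi> (w \<bullet> b)) (scale (\<chi> (- (w \<bullet> (a + b)))) (T (a + b) v)))"
    by (intro sum.cong refl) (simp add: chi)
  also have "\<dots> = scale (\<chi> (w \<bullet> b)) (weight_proj w v)"
    unfolding weight_proj_def scale_sum_right[symmetric]
    by (rule arg_cong[OF sum_translate[OF b, of "\<lambda>a. scale (\<chi> (- (w \<bullet> a))) (T a v)"]])
  finally show "T b (weight_proj w v) = scale (\<chi> (w \<bullet> b)) (weight_proj w v)" .
qed

text \<open>Fourier inversion: summing over the weights leaves only the term of the neutral element.\<close>
lemma sum_weight_proj:
  "(\<Sum>w\<in>carrier_vec m. weight_proj w v) = scale (of_nat (card (carrier_vec m :: 'r vec set))) v"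
proof -
  have coeff: "(\<Sum>w\<in>carrier_vec m. \<chi> (- (w \<bullet> a))) =
      (if a = 0\<^sub>v m then of_nat (card (carrier_vec m :: 'r vec set)) else 0)"
    if a: "a \<in> carrier_vec m" for a
  proof (cases "a = 0\<^sub>v m")
    case True
    then show ?thesis by (simp add: chi_zero)
  next
    case False
    have "- a \<noteq> 0\<^sub>v m" using False a by (metis uminus_uminus_vec uminus_zero_vec)
    moreover have "- (w \<bullet> a) = (- a) \<bullet> w" if "w \<in> carrier_vec m" for w
      using that a by (simp add: comm_scalar_prod[of w m a])
    ultimately show ?thesis using sum_chi_eq_0[of "- a"] a False by (simp cong: sum.cong)
  qed
  have "(\<Sum>w\<in>carrier_vec m. weight_proj w v) =
      (\<Sum>a\<in>carrier_vec m. scale (\<Sum>w\<in>carrier_vec m. \<chi> (- (w \<bullet> a))) (T a v))"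
    unfolding weight_proj_def scale_sum_left by (rule sum.swap)
  also have "\<dots> = (\<Sum>a\<in>carrier_vec m. if a = (0\<^sub>v m :: 'r vec)
      then scale (of_nat (card (carrier_vec m :: 'r vec set))) v else 0)"
    by (rule sum.cong[OF refl]) (simp add: coeff T_zero)
  finally show ?thesis by simp
qed

lemma card_vec_nonzero: "(of_nat (card (carrier_vec m :: 'r vec set)) :: 'k) \<noteq> 0"
  using zero_carrier_vec[of m, where ?'a = 'r] by (auto simp: card_eq_0_iff simp del: zero_carrier_vec)

lemma weight_proj_weight_vector:
  assumes "w \<in> carrier_vec m" "w' \<in> carrier_vec m" "v \<in> weight_space w'"
  shows "weight_proj w v = (if w = w' then scale (of_nat (card (carrier_vec m :: 'r vec set))) v else 0)"
proof -
  have chi: "\<chi> (- (w \<bullet> a)) * \<chi> (w' \<bullet> a) = \<chi> ((w' - w) \<bullet> a)" if "a \<in> carrier_vec m" for a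
    using that assms by (simp add: chi_add[symmetric] minus_scalar_prod_distrib[of _ m])
  have "weight_proj w v = (\<Sum>a\<in>carrier_vec m. scale (\<chi> ((w' - w) \<bullet> a)) v)"
    unfolding weight_proj_def
    using assms by (intro sum.cong refl) (auto simp: weight_space_def chi)
  also have "\<dots> = scale (\<Sum>a\<in>carrier_vec m. \<chi> ((w' - w) \<bullet> a)) v"
    by (simp add: scale_sum_left)
  also have "\<dots> = (if w = w' then scale (of_nat (card (carrier_vec m :: 'r vec set))) v else 0)"
  proof (cases "w = w'")
    case True
    then show ?thesis using assms by (simp add: chi_zero)
  next
    case False
    have "w' - w \<noteq> 0\<^sub>v m"
    proof
      assume eq: "w' - w = 0\<^sub>v m"
      have "w = w'"
      proof (rule eq_vecI)
        fix i assume "i < dim_vec w'"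
        then show "w $ i = w' $ i" using arg_cong[OF eq, of "\<lambda>u. u $ i"] assms by simp
      qed (use assms in auto)
      with False show False ..
    qed
    then show ?thesis using False assms by (subst sum_chi_eq_0) auto
  qed
  finally show ?thesis .
qed

text \<open>
  Otherwise only the projection for weight 0 survives in the Fourier inversion formula, and its
  image consists of invariant vectors.
\<close>
lemma nontrivial_weight_exists:
  assumes b: "b \<in> carrier_vec m" "T b v \<noteq> v"
  shows "\<exists>w\<in>carrier_vec m. w \<noteq> 0\<^sub>v m \<and> (\<exists>u\<in>weight_space w. u \<noteq> 0)"
proof (rule ccontr)
  assume contra: "\<not> ?thesis"
  let ?C = "of_nat (card (carrier_vec m :: 'r vec set)) :: 'k"
  have "weight_proj w v = 0" if "w \<in> carrier_vec m - {0\<^sub>v m}" for w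
    using contra that weight_proj_in_weight_space[of w v] by blast
  then have "(\<Sum>w\<in>carrier_vec m. weight_proj w v) = weight_proj (0\<^sub>v m) v"
    by (subst sum.remove[of _ "0\<^sub>v m"]) auto
  then have "scale ?C v \<in> weight_space (0\<^sub>v m)"
    using weight_proj_in_weight_space[of "0\<^sub>v m" v] by (simp add: sum_weight_proj)
  then have "T b (scale ?C v) = scale ?C v"
    using b by (simp add: weight_space_def chi_zero)
  moreover have "T b (scale ?C v) = scale ?C (T b v)"
    using b(1) by (rule T_scale)
  ultimately show False using b card_vec_nonzero by simp
qed

text \<open>The projection for one weight isolates a single coefficient of a linear relation.\<close>
lemma weight_vectors_independent:
  assumes W: "finite W" "W \<subseteq> carrier_vec m"
    and u: "\<And>w. w \<in> W \<Longrightarrow> u w \<in> weight_space w" "\<And>w. w \<in> W \<Longrightarrow> u w \<noteq> 0"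
  shows "inj_on u W" "independent (u ` W)"
proof -
  let ?C = "of_nat (card (carrier_vec m :: 'r vec set)) :: 'k"
  have pr: "weight_proj w (u w') = (if w = w' then scale ?C (u w') else 0)" if "w \<in> W" "w' \<in> W" for w w'
    using that W u by (intro weight_proj_weight_vector) auto
  show inj: "inj_on u W"
  proof (rule inj_onI, rule ccontr)
    fix w w' assume "w \<in> W" "w' \<in> W" "u w = u w'" "w \<noteq> w'"
    then show False using pr[of w w] pr[of w w'] u(2)[of w'] card_vec_nonzero by auto
  qed
  show "independent (u ` W)"
  proof
    assume "dependent (u ` W)"
    then obtain c w where w: "w \<in> W" "c (u w) \<noteq> 0" and c: "(\<Sum>v\<in>u ` W. scale (c v) v) = 0"
      using W by (auto simp: dependent_finite)
    have lin: "weight_proj w (\<Sum>x\<in>W. scale (c (u x)) (u x)) = (\<Sum>x\<in>W. scale (c (u x)) (weight_proj w (u x)))"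
    proof -
      have "T a (\<Sum>x\<in>W. scale (c (u x)) (u x)) = (\<Sum>x\<in>W. scale (c (u x)) (T a (u x)))"
        if "a \<in> carrier_vec m" for a
        using that by (simp add: T_sum T_scale)
      then show ?thesis
        unfolding weight_proj_def scale_sum_right
        by (subst sum.swap) (simp add: scale_sum_right mult.commute)
    qed
    have zero: "weight_proj w 0 = 0"
      unfolding weight_proj_def
      by (intro sum.neutral) (auto simp: T_0)
    have "0 = weight_proj w (\<Sum>x\<in>W. scale (c (u x)) (u x))"
      using c inj by (simp add: sum.reindex zero)
    also have "\<dots> = (\<Sum>x\<in>W. if x = w then scale (c (u w)) (scale ?C (u w)) else 0)"
      unfolding lin using w by (intro sum.cong) (auto simp: pr)
    also have "\<dots> = scale (c (u w)) (scale ?C (u w))" using w W by simp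
    finally show False using w u card_vec_nonzero by auto
  qed
qed

end

section \<open>Orbits of transvections over a chain ring\<close>

text \<open>
  Let \<open>S\<close> be closed under adding a multiple of one coordinate to another. A coordinate that divides
  all coordinates of the start and of the target serves as a pivot from which all other coordinates
  are adjusted one at a time (\<open>spread\<close> in the proof). Over a chain ring some coordinate \<open>j\<close> of a
  nonzero vector divides all the others, and \<open>d\<close> is its value. To reach \<open>d \<cdot> x\<close> with \<open>x l\<close> a unit, the value \<open>d \<cdot> x l\<close>
  is placed at \<open>l\<close> first, which then serves as a pivot itself; if \<open>j = l\<close>, the value \<open>d\<close> is first
  copied to some other place, which needs \<open>m \<ge> 2\<close>.
\<close>
lemma chain_ring_orbit:
  fixes S :: "'r :: comm_ring_1 vec \<Rightarrow> bool"
  assumes total: "\<And>x y :: 'r. x dvd y \<or> y dvd x"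
    and m: "m \<ge> 2"
    and S_add: "\<And>w i j t. S w \<Longrightarrow> w \<in> carrier_vec m \<Longrightarrow> i < m \<Longrightarrow> j < m \<Longrightarrow> i \<noteq> j \<Longrightarrow>
      S (w + (t * w $ j) \<cdot>\<^sub>v unit_vec m i)"
    and w: "S w" "w \<in> carrier_vec m" "w \<noteq> 0\<^sub>v m"
  obtains d where "d \<noteq> 0" "\<And>x l. l < m \<Longrightarrow> x l dvd 1 \<Longrightarrow> S (vec m (\<lambda>i. d * x i))"
proof -
  have spread: "S u"
    if w: "S w" "w \<in> carrier_vec m" and u: "u \<in> carrier_vec m" and j: "j < m" "u $ j = w $ j"
      and dvd: "\<And>i. i < m \<Longrightarrow> w $ j dvd w $ i" "\<And>i. i < m \<Longrightarrow> w $ j dvd u $ i" for w u j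
  proof -
    have "S (vec m (\<lambda>i. if i < k then u $ i else w $ i))" if "k \<le> m" for k
      using that
    proof (induction k)
      case 0
      have "vec m (\<lambda>i. if i < 0 then u $ i else w $ i) = w" using w by auto
      with w show ?case by simp
    next
      case (Suc k)
      let ?v = "vec m (\<lambda>i. if i < k then u $ i else w $ i)"
      let ?v' = "vec m (\<lambda>i. if i < Suc k then u $ i else w $ i)"
      show ?case
      proof (cases "k = j")
        case True
        then have "?v' = ?v" using j by (auto simp: less_Suc_eq)
        with Suc show ?thesis by simp
      next
        case False
        have "w $ j dvd u $ k - w $ k" using dvd Suc.prems by simp
        then obtain t where t: "u $ k - w $ k = t * w $ j" by (metis dvdE mult.commute)
        have "?v' = ?v + (t * ?v $ j) \<cdot>\<^sub>v unit_vec m k"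
          using j t Suc.prems by (intro eq_vecI) (auto simp: less_Suc_eq algebra_simps)
        then show ?thesis using S_add[of ?v k j t] Suc False j by simp
      qed
    qed
    moreover have "vec m (\<lambda>i. if i < m then u $ i else w $ i) = u" using u by (intro eq_vecI) auto
    ultimately show ?thesis by (metis order_refl)
  qed
  have "\<exists>j\<in>I. \<forall>i\<in>I. w $ j dvd w $ i" if "finite I" "I \<noteq> {}" for I
    using that
  proof (induction I rule: finite_ne_induct)
    case (insert x I)
    then obtain j where j: "j \<in> I" "\<forall>i\<in>I. w $ j dvd w $ i" by blast
    show ?case
    proof (cases "w $ j dvd w $ x")
      case False
      with total have "w $ x dvd w $ j" by blast
      with j show ?thesis by (auto intro: dvd_trans)
    qed (use j in auto)
  qed simp
  from this[of "{..<m}"] m obtain j where j: "j < m" "\<And>i. i < m \<Longrightarrow> w $ j dvd w $ i"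
    by (auto simp: lessThan_empty_iff)
  define d where "d = w $ j"
  have "d \<noteq> 0"
  proof
    assume "d = 0"
    then have "w = 0\<^sub>v m" using j w(2) by (intro eq_vecI) (auto simp: d_def)
    with w(3) show False ..
  qed
  moreover have "S (vec m (\<lambda>i. d * x i))" if l: "l < m" "x l dvd 1" for x l
  proof -
    have via: "S (vec m (\<lambda>i. d * x i))"
      if v: "S v" "v \<in> carrier_vec m" "j' < m" "j' \<noteq> l" "v $ j' = d" "\<And>i. i < m \<Longrightarrow> d dvd v $ i" for v j'
    proof -
      let ?v = "vec m (\<lambda>i. if i = l then d * x l else v $ i)"
      have v': "S ?v" using v l by (intro spread[OF v(1,2), of _ j']) auto
      obtain z where z: "1 = x l * z" using l(2) by (auto simp: dvd_def)
      have dl: "d * x l dvd d"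
        using z by (intro dvdI[of _ _ z]) (metis mult.assoc mult.right_neutral)
      show ?thesis
        by (rule spread[OF v', of _ l]) (use v l dl in \<open>auto intro: dvd_trans\<close>)
    qed
    show ?thesis
    proof (cases "j = l")
      case False
      then show ?thesis using via[of w j] w j by (simp add: d_def)
    next
      case True
      obtain j' where j': "j' < m" "j' \<noteq> l"
        using m that[of "if l = 0 then 1 else 0"] by auto
      let ?v = "vec m (\<lambda>i. if i = j' then d else w $ i)"
      have "S ?v" using w j j' True by (intro spread[OF w(1,2), of _ j]) (auto simp: d_def)
      then show ?thesis using j j' by (intro via[of ?v j']) (auto simp: d_def)
    qed
  qed
  ultimately show ?thesis by (rule that)
qed

section \<open>The ring of integers modulo a prime power\<close>

lemma of_int_card_mod_ring [simp]: "of_int (int CARD('q)) = (0 :: 'q :: nontriv mod_ring)"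
  by (simp del: of_nat_card_eq_0 flip: of_nat_card_eq_0)

lemma of_int_to_int_mod_ring: "of_int (to_int_mod_ring x) = (x :: 'q :: nontriv mod_ring)"
  by (simp add: of_int_of_int_mod_ring)

lemma of_int_gcd_mod_ring:
  "\<exists>s. of_int (gcd a (int CARD('q))) = of_int s * (of_int a :: 'q :: nontriv mod_ring)"
proof -
  obtain s t where st: "s * a + t * int CARD('q) = gcd a (int CARD('q))"
    using bezout_int by blast
  have "(of_int (s * a + t * int CARD('q)) :: 'q mod_ring) = of_int s * of_int a"
    by (simp only: of_int_add of_int_mult of_int_card_mod_ring mult_zero_right add_0_right)
  then show ?thesis unfolding st by blast
qed

lemma of_int_unit_mod_ring:
  assumes "coprime a (int CARD('q))"
  shows "(of_int a :: 'q :: nontriv mod_ring) dvd 1"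
proof -
  obtain s where "of_int (gcd a (int CARD('q))) = of_int s * (of_int a :: 'q mod_ring)"
    using of_int_gcd_mod_ring by blast
  then have "1 = of_int a * (of_int s :: 'q mod_ring)" using assms by (simp add: mult.commute)
  then show ?thesis by (rule dvdI)
qed

text \<open>
  Every residue is associated to its greatest common divisor with \<open>q\<close>, which is a power of \<open>p\<close>;
  powers of \<open>p\<close> are comparable for divisibility.
\<close>
lemma mod_ring_dvd_total:
  fixes x y :: "'q :: nontriv mod_ring"
  assumes p: "prime p" and q: "CARD('q) = p ^ k"
  shows "x dvd y \<or> y dvd x"
proof -
  define g where "g x = gcd (to_int_mod_ring x) (int CARD('q))" for x :: "'q mod_ring"
  have dvd: "x dvd y" if "g x dvd g y" for x y :: "'q mod_ring"
  proof -
    have "g x dvd to_int_mod_ring y" using that by (simp add: g_def)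
    then obtain z where z: "to_int_mod_ring y = g x * z" by (auto simp: dvd_def)
    obtain s where s: "of_int (g x) = of_int s * (of_int (to_int_mod_ring x) :: 'q mod_ring)"
      unfolding g_def using of_int_gcd_mod_ring by blast
    have "y = of_int (g x * z)" using of_int_to_int_mod_ring[of y] z by simp
    also have "\<dots> = x * (of_int s * of_int z)" using s by (simp add: of_int_to_int_mod_ring ac_simps)
    finally show ?thesis by (rule dvdI)
  qed
  have pow: "\<exists>i. g x = int p ^ i" for x
  proof -
    have "nat (g x) dvd p ^ k" using q by (simp add: g_def nat_dvd_iff)
    then obtain i where "nat (g x) = p ^ i" using p by (auto simp: divides_primepow_nat)
    then have "g x = int p ^ i" by (metis g_def gcd_ge_0_int int_nat_eq of_nat_power)
    then show ?thesis ..
  qed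
  obtain i j where "g x = int p ^ i" "g y = int p ^ j" using pow by metis
  then have "g x dvd g y \<or> g y dvd g x" using le_imp_power_dvd[of i j "int p"] le_imp_power_dvd[of j i "int p"]
    by (metis nat_le_linear)
  with dvd show ?thesis by blast
qed

lemma of_nat_diff_unit_mod_ring:
  assumes p: "prime p" and q: "CARD('q) = p ^ k" and "a < p" "b < p" "a \<noteq> b"
  shows "(of_nat a - of_nat b :: 'q :: nontriv mod_ring) dvd 1"
proof -
  have "\<not> int p dvd int a - int b"
    using assms(3-5) dvd_imp_le_int[of "int a - int b" "int p"] by auto
  then have "coprime (int p) (int a - int b)"
    using p by (intro prime_imp_coprime_int) auto
  then have "coprime (int a - int b) (int CARD('q))" by (simp add: q ac_simps)
  then have "(of_int (int a - int b) :: 'q mod_ring) dvd 1" by (rule of_int_unit_mod_ring)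
  then show ?thesis by simp
qed

text \<open>
  A zero \<open>y\<close> of \<open>1 + y + \<dots> + y\<^bsup>p-1\<^esup>\<close> is a primitive \<open>p\<close>-th root of unity: the value of this
  polynomial at 1 is \<open>p\<close>, which is nonzero in characteristic 0. Take a \<open>p\<^sup>k\<close>-th root of \<open>y\<close>.
\<close>
lemma primitive_root_exists:
  assumes p: "prime p"
  shows "\<exists>\<zeta> :: 'k :: {alg_closed_field, field_char_0}. \<zeta> ^ p ^ Suc k = 1 \<and> \<zeta> ^ p ^ k \<noteq> 1"
proof -
  have p1: "p > 1" using p by (rule prime_gt_1_nat)
  obtain y :: 'k where y: "(\<Sum>i\<le>p - 1. y ^ i) = 0"
    using alg_closed[of "p - 1" "\<lambda>_. 1 :: 'k"] p1 by auto
  have "y ^ p = 1" using sum_gp_basic[of y "p - 1"] y p1 by simp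
  moreover have "y \<noteq> 1" using y p1 by (auto simp flip: of_nat_Suc)
  moreover obtain \<zeta> :: 'k where "\<zeta> ^ p ^ k = y" using nth_root_exists[of "p ^ k" y] p1 by auto
  ultimately have "\<zeta> ^ p ^ Suc k = 1 \<and> \<zeta> ^ p ^ k \<noteq> 1" by (metis power_Suc2 power_mult)
  then show ?thesis ..
qed

text \<open>
  The exponents \<open>e\<close> with \<open>\<zeta> ^ e = 1\<close> are closed under greatest common divisors, and a proper divisor
  of \<open>p\<^bsup>k+1\<^esup>\<close> divides \<open>p\<^sup>k\<close>.
\<close>
lemma primitive_root_power:
  fixes \<zeta> :: "'k :: monoid_mult"
  assumes p: "prime p" and \<zeta>: "\<zeta> ^ p ^ Suc k = 1" "\<zeta> ^ p ^ k \<noteq> 1" and a: "\<zeta> ^ a = 1"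
  shows "p ^ Suc k dvd a"
proof -
  let ?g = "gcd a (p ^ Suc k)"
  have "\<zeta> ^ ?g = 1"
  proof (cases "a = 0")
    case False
    then obtain s t where "a * s = p ^ Suc k * t + ?g" using bezout_nat by blast
    then have "\<zeta> ^ (a * s) = \<zeta> ^ (p ^ Suc k * t) * \<zeta> ^ ?g" by (simp only: power_add)
    then show ?thesis using \<zeta>(1) a by (simp only: power_mult power_one mult_1_left)
  qed (use \<zeta> in simp)
  obtain i where i: "i \<le> Suc k" "?g = p ^ i"
    using divides_primepow_nat[OF p, of ?g "Suc k"] by auto
  have "i = Suc k"
  proof (rule ccontr)
    assume "i \<noteq> Suc k"
    then have "p ^ k = ?g * p ^ (k - i)" using i by (simp add: power_add[symmetric])
    then have "\<zeta> ^ p ^ k = 1" using \<open>\<zeta> ^ ?g = 1\<close> by (simp only: power_mult power_one)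
    with \<zeta> show False by simp
  qed
  with i show ?thesis by (metis gcd_dvd1)
qed

lemma faithful_character_exists:
  assumes p: "prime p" and q: "CARD('q) = p ^ k"
  shows "\<exists>\<chi> :: 'q :: nontriv mod_ring \<Rightarrow> 'k :: {alg_closed_field, field_char_0}.
    \<chi> 0 = 1 \<and> (\<forall>x y. \<chi> (x + y) = \<chi> x * \<chi> y) \<and> (\<forall>x. \<chi> x = 1 \<longrightarrow> x = 0)"
proof -
  have "k \<noteq> 0" using q nontriv[where 'a = 'q] by (intro notI) simp
  then obtain l where l: "k = Suc l" by (cases k) auto
  obtain \<zeta> :: 'k where \<zeta>: "\<zeta> ^ p ^ Suc l = 1" "\<zeta> ^ p ^ l \<noteq> 1"
    using primitive_root_exists[OF p] by blast
  have \<zeta>q: "\<zeta> ^ CARD('q) = 1" using \<zeta>(1) by (simp add: q l)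
  have \<zeta>mod: "\<zeta> ^ (a mod CARD('q)) = \<zeta> ^ a" for a
  proof -
    have "\<zeta> ^ a = \<zeta> ^ (CARD('q) * (a div CARD('q)) + a mod CARD('q))" by simp
    also have "\<dots> = \<zeta> ^ (a mod CARD('q))" by (simp only: power_add power_mult \<zeta>q power_one mult_1_left)
    finally show ?thesis by simp
  qed
  define r where "r x = nat (to_int_mod_ring x)" for x :: "'q mod_ring"
  have range: "0 \<le> to_int_mod_ring x \<and> to_int_mod_ring x < int CARD('q)" for x :: "'q mod_ring"
    using range_to_int_mod_ring[where 'a = 'q] by (metis atLeastLessThan_iff rangeI)
  have r_add: "r (x + y) = (r x + r y) mod CARD('q)" for x y
    using range[of x] range[of y]
    by (simp add: r_def to_int_mod_ring_add nat_mod_distrib nat_add_distrib)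
  have r_zero: "x = 0" if "CARD('q) dvd r x" for x
  proof -
    have "r x < CARD('q)" using range[of x] by (simp add: r_def nat_less_iff)
    with that have "r x = 0" by (metis dvd_imp_le neq0_conv not_le)
    then have "to_int_mod_ring x = 0" using range[of x] by (simp add: r_def)
    then show ?thesis by (metis of_int_0 of_int_to_int_mod_ring)
  qed
  show ?thesis
  proof (intro exI[of _ "\<lambda>x. \<zeta> ^ r x"] conjI allI impI)
    show "\<zeta> ^ r 0 = 1" by (simp add: r_def)
    show "\<zeta> ^ r (x + y) = \<zeta> ^ r x * \<zeta> ^ r y" for x y by (simp add: r_add \<zeta>mod power_add)
    show "x = 0" if "\<zeta> ^ r x = 1" for x
      using primitive_root_power[OF p \<zeta> that] by (intro r_zero) (simp add: q l)
  qed
qed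


section \<open>The normal closure of the shears in one column\<close>

text \<open>
  The Steinberg relation \<open>[E\<^sub>r\<^sub>s(a), E\<^sub>s\<^sub>c(t)] = E\<^sub>r\<^sub>c(at)\<close>, for all rows \<open>r\<close> at once and without inverses.
\<close>
lemma shear_commutator:
  assumes "c < n" "s < n" "c \<noteq> s" "a c = 0" "a s = 0"
  shows "shear n s a * shear n c (\<lambda>r. if r = s then t else 0) =
    shear n c (\<lambda>r. a r * t) * (shear n c (\<lambda>r. if r = s then t else 0) * shear n s a)"
  by (rule eq_matI)
    (use assms in \<open>auto simp: shear_mult_index[OF mult_carrier_mat[of _ n n]]
      shear_mult_index[where nc = n] shear_index mult_carrier_mat[of _ n n]\<close>)

text \<open>
  A transvection normalises the group of shears in column \<open>m\<close> and acts on it by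
  row operations on the column.
\<close>
lemma shear_conjugate:
  assumes "i < n" "j < n" "m < n" "i \<noteq> j" "i \<noteq> m" "j \<noteq> m"
  shows "shear n m a * shear n i (\<lambda>r. if r = j then - t else 0) =
    shear n i (\<lambda>r. if r = j then - t else 0) * shear n m (\<lambda>r. a r + (if r = j then t * a i else 0))"
  by (rule eq_matI) (use assms in \<open>auto simp: shear_mult_index[where nc = n] shear_index\<close>)

lemma (in group_hom) commutator_kernel:
  assumes "x \<in> carrier G" "y \<in> carrier G" "z \<in> carrier G" "x \<otimes> y = z \<otimes> (y \<otimes> x)"
    and "h x = \<one>\<^bsub>H\<^esub> \<or> h y = \<one>\<^bsub>H\<^esub>"
  shows "h z = \<one>\<^bsub>H\<^esub>"
proof -
  have "h x \<otimes>\<^bsub>H\<^esub> h y = h z \<otimes>\<^bsub>H\<^esub> (h y \<otimes>\<^bsub>H\<^esub> h x)"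
    using assms(1-4) by (metis hom_mult G.m_closed)
  with assms(1-3,5) show ?thesis by auto
qed

text \<open>
  The commutator relation first transports column \<open>m\<close> to every other column, except for the entry in
  row \<open>m\<close>. That entry is the commutator of entries in places \<open>(m, s)\<close> and \<open>(s, c)\<close> with a third index \<open>s\<close>,
  the second of which is already known to be in the kernel. The third index exists because \<open>n \<ge> 3\<close>.
\<close>
lemma column_shears_normal_closure:
  fixes h :: "'a :: comm_ring_1 mat \<Rightarrow> 'h"
  assumes h: "group_hom (SL n) H h"
    and total: "\<And>x y :: 'a. x dvd y \<or> y dvd x"
    and n: "n \<ge> 3" and m: "m < n"
    and column: "\<And>a. a m = 0 \<Longrightarrow> h (shear n m a) = \<one>\<^bsub>H\<^esub>"
    and A: "A \<in> carrier (SL n)"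
  shows "h A = \<one>\<^bsub>H\<^esub>"
proof -
  interpret group_hom "SL n" H h by (rule h)
  let ?single = "\<lambda>s (t :: 'a) r. if r = s then t else 0"
  have comm: "h (shear n c (\<lambda>r. a r * t)) = \<one>\<^bsub>H\<^esub>"
    if "c < n" "s < n" "c \<noteq> s" "a c = 0" "a s = 0"
      "h (shear n s a) = \<one>\<^bsub>H\<^esub> \<or> h (shear n c (?single s t)) = \<one>\<^bsub>H\<^esub>" for c s a t
    by (rule commutator_kernel[of "shear n s a" "shear n c (?single s t)"])
      (use that in \<open>auto simp: shear_in_SL SL_mult shear_commutator\<close>)
  have off_row: "h (shear n c a) = \<one>\<^bsub>H\<^esub>" if "c < n" "c \<noteq> m" "a c = 0" "a m = 0" for c a
    using comm[of c m a 1] that m column by simp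
  have row: "h (shear n c (?single m t)) = \<one>\<^bsub>H\<^esub>" if c: "c < n" "c \<noteq> m" for c t
  proof -
    have "\<not> {..<n} \<subseteq> {c, m}"
      using n card_mono[of "{c, m}" "{..<n}"] by (auto simp: card_insert_if split: if_splits)
    then obtain s where s: "s < n" "s \<noteq> c" "s \<noteq> m" by auto
    have "h (shear n c (\<lambda>r. ?single m 1 r * t)) = \<one>\<^bsub>H\<^esub>"
      using c m s by (intro comm[of c s]) (auto intro!: off_row)
    moreover have "(\<lambda>r. ?single m 1 r * t) = ?single m t" by auto
    ultimately show ?thesis by simp
  qed
  have all: "h (shear n c y) = \<one>\<^bsub>H\<^esub>" if c: "c < n" "y c = 0" for c y
  proof (cases "c = m")
    case True
    with c column show ?thesis by simp
  next
    case False
    have "shear n c y = shear n c (?single m (y m)) * shear n c (y(m := 0))"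
      using c False by (subst shear_mult_shear) (auto intro!: arg_cong[of _ _ "shear n c"] ext)
    also have "h \<dots> = h (shear n c (?single m (y m))) \<otimes>\<^bsub>H\<^esub> h (shear n c (y(m := 0)))"
      using c False hom_mult[of "shear n c (?single m (y m))" "shear n c (y(m := 0))"]
      by (simp add: SL_mult shear_in_SL)
    finally show ?thesis using c False row off_row by simp
  qed
  show ?thesis
  proof (rule SL_shear_reduce[where P = "\<lambda>A. h A = \<one>\<^bsub>H\<^esub>" and n = n, OF total])
    show "h (1\<^sub>m n) = \<one>\<^bsub>H\<^esub>" using hom_one by (simp add: SL_def)
    show "h B = \<one>\<^bsub>H\<^esub>" if "i < n" "y i = 0" "B \<in> carrier (SL n)" "h (shear n i y * B) = \<one>\<^bsub>H\<^esub>" for i y B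
      using that all[of i y] hom_mult[of "shear n i y" B] by (simp add: SL_mult shear_in_SL)
  qed (use n A in auto)
qed

section \<open>Irreducible representations of finite groups\<close>

context linear_representation
begin

lemma rho_linear: "g \<in> carrier G \<Longrightarrow> Vector_Spaces.linear scale scale (\<rho> g)"
  and rho_bij: "g \<in> carrier G \<Longrightarrow> bij (\<rho> g)"
  using hom_closed[of g] by (auto simp: GL_def)

lemma rho_mult: "g \<in> carrier G \<Longrightarrow> g' \<in> carrier G \<Longrightarrow> \<rho> (g \<otimes> g') v = \<rho> g (\<rho> g' v)"
  using hom_mult[of g g'] by (simp add: GL_def)

lemma rho_one: "\<rho> \<one> v = v"
  using hom_one by (simp add: GL_def)

lemma rho_scale: "g \<in> carrier G \<Longrightarrow> \<rho> g (scale c v) = scale c (\<rho> g v)"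
  and rho_0: "g \<in> carrier G \<Longrightarrow> \<rho> g 0 = 0"
  and rho_span: "g \<in> carrier G \<Longrightarrow> \<rho> g ` span X = span (\<rho> g ` X)"
proof -
  assume "g \<in> carrier G"
  then interpret g: Vector_Spaces.linear scale scale "\<rho> g" by (rule rho_linear)
  show "\<rho> g (scale c v) = scale c (\<rho> g v)" "\<rho> g 0 = 0" by (rule g.scale g.zero)+
  show "\<rho> g ` span X = span (\<rho> g ` X)" by (rule g.span_image[symmetric])
qed

text \<open>The orbit of a nonzero vector spans an invariant subspace.\<close>
lemma irreducible_finite_spanning_set:
  assumes irr: irreducible and fin: "finite (carrier G)"
  shows "\<exists>X. finite X \<and> span X = UNIV"
proof -
  obtain v :: 'v where v: "v \<noteq> 0" using irr by (auto simp: irreducible_def)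
  define X where "X = (\<lambda>g. \<rho> g v) ` carrier G"
  have "invariant (span X)"
    unfolding invariant_def
  proof (intro ballI)
    fix g w assume g: "g \<in> carrier G" and "w \<in> span X"
    then have "\<rho> g w \<in> span (\<rho> g ` X)" by (metis imageI rho_span)
    moreover have "\<rho> g (\<rho> g' v) \<in> X" if "g' \<in> carrier G" for g'
      unfolding X_def using g that by (intro image_eqI[of _ _ "g \<otimes> g'"]) (simp_all add: rho_mult del: hom_mult)
    then have "\<rho> g ` X \<subseteq> X" by (auto simp: X_def)
    ultimately show "\<rho> g w \<in> span X" using span_mono by blast
  qed
  moreover have "v \<in> span X"
    using rho_one[of v] by (intro span_base) (force simp: X_def)
  ultimately have "span X = UNIV"
    using irr v unfolding irreducible_def by (metis singletonD subspace_span)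
  moreover have "finite X" using fin by (simp add: X_def)
  ultimately show ?thesis by blast
qed

text \<open>
  Finite-dimensionality is essential here, since \<open>dim UNIV\<close> would be 0 for an infinite basis.
\<close>
lemma independent_card_le_dim_UNIV:
  assumes "irreducible" "finite (carrier G)" "independent B"
  shows "card B \<le> dim UNIV"
proof -
  obtain X where X: "finite X" "span X = UNIV"
    using irreducible_finite_spanning_set[OF assms(1,2)] by blast
  obtain B' where B': "B' \<subseteq> X" "independent B'" "X \<subseteq> span B'"
    using maximal_independent_subset by blast
  have "span B' = UNIV" using X B' span_minimal[OF B'(3)] by auto
  with B' X interpret finite_dimensional_vector_space scale B'
    by unfold_locales (auto intro: finite_subset)
  show ?thesis using assms(3) by (intro independent_card_le_dim) auto
qed

end

section \<open>Counting weights\<close>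

lemma finite_SL: "finite (carrier (SL n :: 'a :: {finite, comm_ring_1} mat monoid))"
proof (rule finite_subset)
  show "carrier (SL n) \<subseteq> (\<lambda>f. mat n n f) ` (({..<n} \<times> {..<n}) \<rightarrow>\<^sub>E (UNIV :: 'a set))"
  proof
    fix A :: "'a mat" assume "A \<in> carrier (SL n)"
    then show "A \<in> (\<lambda>f. mat n n f) ` (({..<n} \<times> {..<n}) \<rightarrow>\<^sub>E (UNIV :: 'a set))"
      by (intro image_eqI[of _ _ "\<lambda>x\<in>{..<n} \<times> {..<n}. A $$ x"] eq_matI) (auto simp: SL_def)
  qed
  show "finite ((\<lambda>f. mat n n f) ` (({..<n} \<times> {..<n}) \<rightarrow>\<^sub>E (UNIV :: 'a set)))"
    by (intro finite_imageI finite_PiE) auto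
qed

lemma card_residue_vectors:
  "card {x \<in> {..<m} \<rightarrow>\<^sub>E {..<p}. \<exists>l<m. x l \<noteq> (0::nat)} = p ^ m - 1" if "p > 0"
proof -
  have "{x \<in> {..<m} \<rightarrow>\<^sub>E {..<p}. \<exists>l<m. x l \<noteq> 0} = ({..<m} \<rightarrow>\<^sub>E {..<p}) - {\<lambda>l\<in>{..<m}. 0}"
    by (auto simp: PiE_iff extensional_def fun_eq_iff)
  then show ?thesis
    using that by (simp add: card_Diff_singleton card_PiE)
qed

lemma scaled_residue_vectors_inj:
  fixes d :: "'q :: nontriv mod_ring"
  assumes p: "prime p" and q: "CARD('q) = p ^ k" and d: "d \<noteq> 0"
  shows "inj_on (\<lambda>x. vec m (\<lambda>i. d * of_nat (x i))) ({..<m} \<rightarrow>\<^sub>E {..<p})"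
proof (rule inj_onI)
  fix x y assume x: "x \<in> {..<m} \<rightarrow>\<^sub>E {..<p}" and y: "y \<in> {..<m} \<rightarrow>\<^sub>E {..<p}"
    and eq: "vec m (\<lambda>i. d * of_nat (x i)) = vec m (\<lambda>i. d * of_nat (y i))"
  show "x = y"
  proof (rule PiE_ext[OF x y], rule ccontr)
    fix i assume i: "i \<in> {..<m}" and "x i \<noteq> y i"
    then have "(of_nat (x i) - of_nat (y i) :: 'q mod_ring) dvd 1"
      using x y by (intro of_nat_diff_unit_mod_ring[OF p q]) auto
    then obtain z :: "'q mod_ring" where z: "1 = (of_nat (x i) - of_nat (y i)) * z" by (elim dvdE)
    have "d * of_nat (x i) = d * of_nat (y i)"
      using i arg_cong[OF eq, of "\<lambda>v. v $ i"] by simp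
    then have "d * (of_nat (x i) - of_nat (y i)) * z = 0" by (simp add: algebra_simps)
    with z d show False by (metis mult.assoc mult.right_neutral)
  qed
qed

theorem theorem2p27:
  fixes n p k :: nat
    and scale :: "'k :: {alg_closed_field, field_char_0} \<Rightarrow> 'v :: ab_group_add \<Rightarrow> 'v"
    and \<rho> :: "'q :: nontriv mod_ring mat \<Rightarrow> 'v \<Rightarrow> 'v"
  assumes "n \<ge> 3"
    and "prime p"
    and "CARD('q) = p ^ k"
    and "linear_representation scale (SL n) \<rho>"
    and "linear_representation.nontrivial (SL n) \<rho>"
    and "linear_representation.irreducible scale (SL n) \<rho>"
  shows "vector_space.dim scale (UNIV :: 'v set) \<ge> (if (n, p) = (3, 2) then 2 else p ^ (n - 1) - 1)"
proof -
  interpret linear_representation scale "SL n" \<rho> by fact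
  obtain \<chi> :: "'q mod_ring \<Rightarrow> 'k" where chi: "\<chi> 0 = 1" "\<And>x y. \<chi> (x + y) = \<chi> x * \<chi> y" "\<And>x. \<chi> x = 1 \<Longrightarrow> x = 0"
    using faithful_character_exists[OF assms(2,3)] by blast
  note total = mod_ring_dvd_total[OF assms(2,3)]
  define m where "m = n - 1"
  have m: "m \<ge> 2" "m < n" "n = Suc m" using assms(1) by (auto simp: m_def)
  define N where "N a = shear n m (\<lambda>r. if r < m then a $ r else 0)" for a :: "'q mod_ring vec"
  have N: "N a \<in> carrier (SL n)" for a unfolding N_def using m by (intro shear_in_SL) auto
  have N_cong: "shear n m f = N a" if "f m = 0" "\<And>r. r < m \<Longrightarrow> f r = a $ r" for f a
    using that m by (intro eq_matI) (auto simp: N_def shear_index less_Suc_eq)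
  interpret N: module_rep scale m \<chi> "\<lambda>a. \<rho> (N a)"
  proof (intro module_rep.intro module_rep_axioms.intro)
    show "vector_space scale" by unfold_locales
    show "Vector_Spaces.linear scale scale (\<rho> (N a))" for a using N by (rule rho_linear)
    have "N (0\<^sub>v m) = \<one>\<^bsub>SL n\<^esub>" by (simp add: N_def SL_def shear_zero)
    then show "\<rho> (N (0\<^sub>v m)) v = v" for v by (simp add: rho_one del: hom_one)
    fix a b :: "'q mod_ring vec" and v assume ab: "a \<in> carrier_vec m" "b \<in> carrier_vec m"
    have "N a * N b = shear n m (\<lambda>r. (if r < m then a $ r else 0) + (if r < m then b $ r else 0))"
      unfolding N_def using m by (intro shear_mult_shear) auto
    also have "\<dots> = N (a + b)" using ab by (intro N_cong) auto
    finally show "\<rho> (N (a + b)) v = \<rho> (N a) (\<rho> (N b) v)"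
      using N rho_mult[of "N a" "N b" v] by (simp add: SL_mult)
  qed (use chi in auto)
  have "\<exists>b\<in>carrier_vec m. \<exists>v. \<rho> (N b) v \<noteq> v"
  proof (rule ccontr)
    assume contra: "\<not> ?thesis"
    \<comment> \<open>Only shears with \<open>a m = 0\<close> lie in the translation group, and those are all of the form \<open>N b\<close>.\<close>
    have "\<rho> (shear n m a) = \<one>\<^bsub>GL scale\<^esub>" if "a m = 0" for a
      using that contra N_cong[of a "vec m a"] by (auto simp: GL_def fun_eq_iff)
    then have "\<rho> A = \<one>\<^bsub>GL scale\<^esub>" if "A \<in> carrier (SL n)" for A
      using column_shears_normal_closure[OF group_hom_axioms total assms(1) m(2) _ that] by blast
    then show False using assms(5) by (auto simp: nontrivial_def GL_def)
  qed
  then obtain w where w: "w \<in> carrier_vec m" "w \<noteq> 0\<^sub>v m" "\<exists>u\<in>N.weight_space w. u \<noteq> 0"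
    using N.nontrivial_weight_exists by blast
  \<comment> \<open>Acting by a transvection of the upper left block moves a weight vector to the weight space of the
    transvected weight. The sign makes the action on weights an addition.\<close>
  have move: "\<exists>u\<in>N.weight_space (w + (t * w $ j) \<cdot>\<^sub>v unit_vec m i). u \<noteq> 0"
    if w: "\<exists>u\<in>N.weight_space w. u \<noteq> 0" "w \<in> carrier_vec m" and ij: "i < m" "j < m" "i \<noteq> j" for w i j t
  proof -
    obtain u where u: "u \<in> N.weight_space w" "u \<noteq> 0" using w by blast
    define g where "g = shear n i (\<lambda>r. if r = j then - t else 0)"
    have g: "g \<in> carrier (SL n)" unfolding g_def using ij m by (intro shear_in_SL) auto
    have "\<rho> (N a) (\<rho> g u) = scale (\<chi> ((w + (t * w $ j) \<cdot>\<^sub>v unit_vec m i) \<bullet> a)) (\<rho> g u)"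
      if a: "a \<in> carrier_vec m" for a
    proof -
      define a' where "a' = a + (t * a $ i) \<cdot>\<^sub>v unit_vec m j"
      have a': "a' \<in> carrier_vec m" using a by (simp add: a'_def)
      have "N a * g = g * shear n m
          (\<lambda>r. (if r < m then a $ r else 0) + (if r = j then t * (if i < m then a $ i else 0) else 0))"
        unfolding N_def g_def using ij m by (intro shear_conjugate) auto
      also have "shear n m
          (\<lambda>r. (if r < m then a $ r else 0) + (if r = j then t * (if i < m then a $ i else 0) else 0)) = N a'"
        using ij a by (intro N_cong) (auto simp: a'_def)
      finally have "\<rho> (N a) (\<rho> g u) = \<rho> g (\<rho> (N a') u)"
        using N g by (metis SL_mult rho_mult)
      also have "\<dots> = scale (\<chi> (w \<bullet> a')) (\<rho> g u)"
        using u a' g by (simp add: N.weight_space_def rho_scale)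
      also have "w \<bullet> a' = (w + (t * w $ j) \<cdot>\<^sub>v unit_vec m i) \<bullet> a"
        using w a ij by (simp add: a'_def scalar_prod_add_distrib[of _ m] add_scalar_prod_distrib[of _ m])
      finally show ?thesis .
    qed
    then have "\<rho> g u \<in> N.weight_space (w + (t * w $ j) \<cdot>\<^sub>v unit_vec m i)"
      by (simp add: N.weight_space_def)
    moreover have "\<rho> g u \<noteq> 0"
      using u rho_bij[OF g] rho_0[OF g] by (metis bij_is_inj injD)
    ultimately show ?thesis by blast
  qed
  define S where "S w \<longleftrightarrow> (\<exists>u\<in>N.weight_space w. u \<noteq> 0)" for w
  have S_move: "S (w + (t * w $ j) \<cdot>\<^sub>v unit_vec m i)"
    if "S w" "w \<in> carrier_vec m" "i < m" "j < m" "i \<noteq> j" for w i j t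
    using move[of w i j t] that unfolding S_def by blast
  have Sw: "S w" using w(3) unfolding S_def .
  obtain d where d: "d \<noteq> 0" "\<And>x l. l < m \<Longrightarrow> x l dvd 1 \<Longrightarrow> S (vec m (\<lambda>i. d * x i))"
    by (rule chain_ring_orbit[OF total m(1) S_move Sw w(1,2)]) blast+
  define X where "X = {x \<in> {..<m} \<rightarrow>\<^sub>E {..<p}. \<exists>l<m. x l \<noteq> 0}"
  define W where "W = (\<lambda>x. vec m (\<lambda>i. d * of_nat (x i))) ` X"
  have "finite X" unfolding X_def by (rule finite_subset[of _ "{..<m} \<rightarrow>\<^sub>E {..<p}"]) (auto intro!: finite_PiE)
  then have W: "finite W" "W \<subseteq> carrier_vec m" by (auto simp: W_def)
  have "inj_on (\<lambda>x. vec m (\<lambda>i. d * of_nat (x i))) X"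
    by (rule inj_on_subset[OF scaled_residue_vectors_inj[OF assms(2,3) d(1)]]) (auto simp: X_def)
  then have "card W = card X" unfolding W_def by (rule card_image)
  also have "\<dots> = p ^ m - 1" unfolding X_def using assms(2) by (intro card_residue_vectors prime_gt_0_nat)
  finally have card_W: "card W = p ^ m - 1" .
  have "\<exists>u\<in>N.weight_space w. u \<noteq> 0" if w_in: "w \<in> W" for w
  proof -
    obtain x l where x: "x \<in> {..<m} \<rightarrow>\<^sub>E {..<p}" "w = vec m (\<lambda>i. d * of_nat (x i))" "l < m" "x l \<noteq> 0"
      using w_in by (auto simp: W_def X_def)
    have "(of_nat (x l) - of_nat 0 :: 'q mod_ring) dvd 1"
      using x assms(2) by (intro of_nat_diff_unit_mod_ring[OF assms(2,3)]) (auto simp: prime_gt_0_nat)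
    then show ?thesis using d(2)[of l "\<lambda>i. of_nat (x i)"] x by (simp add: S_def)
  qed
  then obtain u where u: "\<And>w. w \<in> W \<Longrightarrow> u w \<in> N.weight_space w" "\<And>w. w \<in> W \<Longrightarrow> u w \<noteq> 0"
    by metis
  note indep = N.weight_vectors_independent[OF W u]
  have "p ^ m - 1 = card (u ` W)" using card_image[OF indep(1)] card_W by simp
  also have "\<dots> \<le> dim UNIV"
    using assms(6) indep(2) by (intro independent_card_le_dim_UNIV finite_SL)
  finally show ?thesis by (auto simp: m_def)
qed

end
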